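(* Let $G$ be a graph with a $\Delta$-disk representation $\{D_v=D((x_v,y_v),r_v)\}_{v\in V(G)}$. For $u,v\in V(G)$ define $u\prec v$ if and only if $x_u<x_v$, $y_u<y_v$ and $D_u\cap D_v=\emptyset$. Then $\prec$ is a strict partial order on $V(G)$ and two distinct vertices $u,v$ are non-adjacent in $G$ if and only if $u\prec v$ or $v\prec u$. In particular, $G$ is a co-comparability graph.
   Context: A $\Delta$-disk representation of $G$ is a family of closed disks $D_v$ with center $(x_v,y_v)$ and radius $r_v$, for $v\in V(G)$, such that $uv\in E(G)$ iff $D_u\cap D_v\neq\emptyset$, and for every $v$: $x_v>0$, $y_v>0$ and $\max(x_v,y_v)\leq r_v<\sqrt{x_v^2+y_v^2}$. A co-comparability graph is a graph whose vertex set admits a strict partial order in which two distinct vertices are non-adjacent iff they are comparable. *)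

theory Defs
  imports "HOL-Analysis.Analysis"
begin

definition simple_graph :: "'a set \<Rightarrow> 'a set set \<Rightarrow> bool" where
  "simple_graph V E \<longleftrightarrow> (\<forall>e\<in>E. \<exists>u\<in>V. \<exists>v\<in>V. u \<noteq> v \<and> e = {u, v})"

definition strict_partial_order_on :: "'a set \<Rightarrow> ('a \<Rightarrow> 'a \<Rightarrow> bool) \<Rightarrow> bool" where
  "strict_partial_order_on V R \<longleftrightarrow> irreflp_on V R \<and> transp_on V R"

definition cocomparability_graph :: "'a set \<Rightarrow> 'a set set \<Rightarrow> bool" where
  "cocomparability_graph V E \<longleftrightarrow>
     simple_graph V E \<and>
     (\<exists>R. strict_partial_order_on V R \<and>
        (\<forall>u\<in>V. \<forall>v\<in>V. u \<noteq> v \<longrightarrow> ({u, v} \<notin> E \<longleftrightarrow> R u v \<or> R v u)))"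

text \<open>The metric on \<^typ>\<open>real \<times> real\<close> is the Euclidean one, so \<^const>\<open>cball\<close> is a round disk.\<close>

definition disk ::
  "('a \<Rightarrow> real) \<Rightarrow> ('a \<Rightarrow> real) \<Rightarrow> ('a \<Rightarrow> real) \<Rightarrow> 'a \<Rightarrow> (real \<times> real) set" where
  "disk x y r v = cball (x v, y v) (r v)"

text \<open>Adjacency is prescribed for distinct vertices only: graphs have no loops, whereas every
  disk meets itself.\<close>

definition delta_disk_representation ::
  "'a set \<Rightarrow> 'a set set \<Rightarrow> ('a \<Rightarrow> real) \<Rightarrow> ('a \<Rightarrow> real) \<Rightarrow> ('a \<Rightarrow> real) \<Rightarrow> bool" where
  "delta_disk_representation V E x y r \<longleftrightarrow>
     (\<forall>u\<in>V. \<forall>v\<in>V. u \<noteq> v \<longrightarrow> ({u, v} \<in> E \<longleftrightarrow> disk x y r u \<inter> disk x y r v \<noteq> {})) \<and>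
     (\<forall>v\<in>V. x v > 0 \<and> y v > 0 \<and>
        max (x v) (y v) \<le> r v \<and> r v < sqrt ((x v)\<^sup>2 + (y v)\<^sup>2))"

definition delta_less ::
  "('a \<Rightarrow> real) \<Rightarrow> ('a \<Rightarrow> real) \<Rightarrow> ('a \<Rightarrow> real) \<Rightarrow> 'a \<Rightarrow> 'a \<Rightarrow> bool" where
  "delta_less x y r u v \<longleftrightarrow>
     x u < x v \<and> y u < y v \<and> disk x y r u \<inter> disk x y r v = {}"

end

theory Submission
  imports Defs
begin

text \<open>Disjoint disks have comparable centers: if \<open>x\<^sub>u \<le> x\<^sub>v\<close> and \<open>y\<^sub>v \<le> y\<^sub>u\<close>, then
  the point \<open>(x\<^sub>u, y\<^sub>v)\<close> lies in both disks. For transitivity, let \<open>u \<prec> v \<prec> w\<close>. The disk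
  \<open>D\<^sub>v\<close> contains the two segments joining its center to its projections on the axes. The segment
  from the center of \<open>D\<^sub>u\<close> to that of \<open>D\<^sub>w\<close> leaves the rectangle spanned by the origin and the center
  of \<open>D\<^sub>v\<close> through one of these two segments, so it meets \<open>D\<^sub>v\<close>; if \<open>D\<^sub>u\<close> and \<open>D\<^sub>w\<close> met, it would be
  covered by them, and \<open>D\<^sub>v\<close> would meet one of them.\<close>

text \<open>A common point gives \<open>dist a b \<le> r + s\<close>, and a point of the segment
  splits \<open>dist a b\<close> additively, so it cannot be farther than \<open>r\<close> from
  \<open>a\<close> and also farther than \<open>s\<close> from \<open>b\<close>.\<close>

lemma closed_segment_subset_cballs:
  fixes a b :: "'b::euclidean_space"
  assumes "cball a r \<inter> cball b s \<noteq> {}"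
  shows "closed_segment a b \<subseteq> cball a r \<union> cball b s"
proof
  fix p assume p: "p \<in> closed_segment a b"
  obtain z where "dist a z \<le> r" "dist b z \<le> s"
    using assms by auto
  then have "dist a b \<le> r + s"
    using dist_triangle2[of a b z] by linarith
  moreover have "dist a b = dist a p + dist p b"
    using p between between_mem_segment by metis
  ultimately show "p \<in> cball a r \<union> cball b s"
    by (auto simp: dist_commute)
qed

lemma incomparable_centers_cballs_intersect:
  fixes a b c d r s :: real
  assumes "0 < a" "a \<le> c" "c \<le> s" "0 < d" "d \<le> b" "b \<le> r"
  shows "cball (a, b) r \<inter> cball (c, d) s \<noteq> {}"
proof -
  \<comment> \<open>Its distances to the centers are \<open>b - d < b \<le> r\<close> and
    \<open>c - a < c \<le> s\<close>.\<close>
  have "(a, d) \<in> cball (a, b) r \<inter> cball (c, d) s"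
    using assms by (simp add: dist_Pair_Pair dist_real_def)
  then show ?thesis by blast
qed

lemma segment_meets_cball:
  fixes a b c d e f r :: real
  assumes "0 < a" "a < c" "c < e" "0 < b" "b < d" "d < f" "c \<le> r" "d \<le> r"
  shows "closed_segment (a, b) (e, f) \<inter> cball (c, d) r \<noteq> {}"
proof -
  \<comment> \<open>The segment reaches abscissa \<open>c\<close> at parameter \<open>t1\<close> and
    ordinate \<open>d\<close> at \<open>t2\<close>; the smaller one is where it leaves the
    rectangle.\<close>
  define t1 where "t1 = (c - a) / (e - a)"
  define t2 where "t2 = (d - b) / (f - b)"
  define t where "t = min t1 t2"
  have t: "0 \<le> t" "t \<le> 1" "t \<le> t1" "t \<le> t2"
    using assms by (auto simp: t_def t1_def t2_def min_def)
  have t12: "t1 * (e - a) = c - a" "t2 * (f - b) = d - b"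
    using assms by (auto simp: t1_def t2_def)
  define p where "p = a + t * (e - a)"
  define q where "q = b + t * (f - b)"
  have p: "a \<le> p" "p \<le> c" and q: "b \<le> q" "q \<le> d"
    using assms t t12 mult_right_mono[OF t(3), of "e - a"] mult_right_mono[OF t(4), of "f - b"]
    by (auto simp: p_def q_def)
  have "p = c \<or> q = d"
    using t12 by (auto simp: p_def q_def t_def min_def)
  \<comment> \<open>One coordinate agrees; the other differs by \<open>d - q < d\<close> or
    \<open>c - p < c\<close>, since \<open>p\<close> and \<open>q\<close> are positive.\<close>
  then have "dist (c, d) (p, q) \<le> r"
    using assms p q by (auto simp: dist_Pair_Pair dist_real_def)
  moreover have "(p, q) = (1 - t) *\<^sub>R (a, b) + t *\<^sub>R (e, f)"
    by (simp add: p_def q_def algebra_simps)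
  then have "(p, q) \<in> closed_segment (a, b) (e, f)"
    using t unfolding in_segment by blast
  ultimately show ?thesis by auto
qed

lemma delta_less_trans:
  assumes "0 < x u" "0 < y u" "x v \<le> r v" "y v \<le> r v"
    and uv: "delta_less x y r u v" and vw: "delta_less x y r v w"
  shows "delta_less x y r u w"
proof -
  have "closed_segment (x u, y u) (x w, y w) \<inter> disk x y r v \<noteq> {}"
    using assms unfolding delta_less_def disk_def by (intro segment_meets_cball) auto
  then have "\<not> closed_segment (x u, y u) (x w, y w) \<subseteq> disk x y r u \<union> disk x y r w"
    using uv vw unfolding delta_less_def by blast
  then have "disk x y r u \<inter> disk x y r w = {}"
    using closed_segment_subset_cballs unfolding disk_def by blast
  then show ?thesis
    using uv vw unfolding delta_less_def by auto
qed

lemma disjoint_disks_delta_less: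
  assumes "0 < x u" "0 < y u" "x u \<le> r u" "y u \<le> r u"
    and "0 < x v" "0 < y v" "x v \<le> r v" "y v \<le> r v"
    and disj: "disk x y r u \<inter> disk x y r v = {}"
  shows "delta_less x y r u v \<or> delta_less x y r v u"
proof -
  \<comment> \<open>The weak inequalities in the two excluded cases also rule out ties, so both
    coordinates differ strictly and in the same direction.\<close>
  have "\<not> (x u \<le> x v \<and> y v \<le> y u)"
    using incomparable_centers_cballs_intersect[of "x u" "x v" "r v" "y v" "y u" "r u"] assms
    unfolding disk_def by blast
  moreover have "\<not> (x v \<le> x u \<and> y u \<le> y v)"
    using incomparable_centers_cballs_intersect[of "x v" "x u" "r u" "y u" "y v" "r v"] assms
    unfolding disk_def by blast
  ultimately show ?thesis
    using disj unfolding delta_less_def by (auto simp: Int_commute)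
qed

theorem theorem19:
  fixes V :: "'a set" and E :: "'a set set" and x y r :: "'a \<Rightarrow> real"
  assumes "simple_graph V E"
    and "delta_disk_representation V E x y r"
  shows "strict_partial_order_on V (delta_less x y r) \<and>
    (\<forall>u\<in>V. \<forall>v\<in>V. u \<noteq> v \<longrightarrow>
       ({u, v} \<notin> E \<longleftrightarrow> delta_less x y r u v \<or> delta_less x y r v u)) \<and>
    cocomparability_graph V E"
proof -
  have bounds: "0 < x v" "0 < y v" "x v \<le> r v" "y v \<le> r v" if "v \<in> V" for v
    using assms(2) that unfolding delta_disk_representation_def by auto
  have adj: "{u, v} \<in> E \<longleftrightarrow> disk x y r u \<inter> disk x y r v \<noteq> {}"
    if "u \<in> V" "v \<in> V" "u \<noteq> v" for u v
    using assms(2) that unfolding delta_disk_representation_def by blast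
  have order: "strict_partial_order_on V (delta_less x y r)"
    unfolding strict_partial_order_on_def
  proof
    show "irreflp_on V (delta_less x y r)"
      by (rule irreflp_onI) (simp add: delta_less_def)
    show "transp_on V (delta_less x y r)"
    proof (rule transp_onI)
      fix u v w assume "u \<in> V" "v \<in> V" "delta_less x y r u v" "delta_less x y r v w"
      then show "delta_less x y r u w"
        by (intro delta_less_trans[of x u y v r w] bounds)
    qed
  qed
  have comp: "\<forall>u\<in>V. \<forall>v\<in>V. u \<noteq> v \<longrightarrow>
      ({u, v} \<notin> E \<longleftrightarrow> delta_less x y r u v \<or> delta_less x y r v u)"
  proof (intro ballI impI iffI)
    fix u v assume uv: "u \<in> V" "v \<in> V" "u \<noteq> v"
    show "delta_less x y r u v \<or> delta_less x y r v u" if "{u, v} \<notin> E"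
      using that adj[OF uv] by (intro disjoint_disks_delta_less bounds uv) simp
    show "{u, v} \<notin> E" if "delta_less x y r u v \<or> delta_less x y r v u"
      using that adj[OF uv] unfolding delta_less_def by auto
  qed
  show ?thesis
    using assms(1) order comp unfolding cocomparability_graph_def by blast
qed

end
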